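(* Let $\Delta t>0$ denote the time step and let $\mathbf k$ be a wavevector. Applying a Runge–Kutta method with stability function $R$ to the scalar mode equation $$\frac{\mathrm d}{\mathrm dt}\hat\eta_{\mathbf k}(t)=\lambda(\mathbf k)\,\hat\eta_{\mathbf k}(t),\qquad \lambda(\mathbf k)=-M|\mathbf k|^2\bigl(|\mathbf k|^2+\varepsilon^{-2}F''(u_0)+\beta|\mathbf k|^4\bigr),$$ yields $$e^{\Delta t\,\tilde\lambda(\mathbf k)}=R\bigl(\Delta t\,\lambda(\mathbf k)\bigr),$$ where $\tilde\lambda(\mathbf k)$ is the discrete growth rate.
   Context: The mode equation is the Fourier-mode form of the isotropic Cahn–Hilliard equation $u_t=\nabla\cdot(M\nabla\mu)$, $\mu=-\Delta u+\varepsilon^{-2}F'(u)+\beta\Delta^2u$, linearized about a constant state $u_0\in\mathbb{R}$, with constant $M>0$, $\varepsilon>0$, $\beta\ge0$ and bulk potential $F$. For a Runge–Kutta method with coefficient matrix $\mathcal A=(a_{ij})$ and weights $b=(b_i)$, the stability function is $R(z)=1+z\,b^\top(I-z\mathcal A)^{-1}\mathbf 1$ (where $I-z\mathcal A$ is invertible). The discrete growth rate $\tilde\lambda(\mathbf k)\in\mathbb{C}$ is defined by writing the numerical solution $\hat u^n$ of the mode equation at step $n$ as $\hat u^n=U_0\exp\bigl(n\,\Delta t\,\tilde\lambda(\mathbf k)\bigr)$ for all $n\ge0$ with $U_0\neq0$. *)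

theory Defs
  imports "HOL-Analysis.Analysis"
begin

definition mode_rate ::
  "real \<Rightarrow> real \<Rightarrow> real \<Rightarrow> (real \<Rightarrow> real) \<Rightarrow> real \<Rightarrow> real ^ 'd \<Rightarrow> real" where
  "mode_rate M \<epsilon> \<beta> F u\<^sub>0 k =
     - M * norm k ^ 2 *
       (norm k ^ 2 + inverse (\<epsilon> ^ 2) * deriv (deriv F) u\<^sub>0 + \<beta> * norm k ^ 4)"

text \<open>
  One step of size \<open>h\<close> for the autonomous equation \<open>y' = f y\<close>, with stage values \<open>Y i\<close>.
  It is a relation because the stage equations of an implicit method may have no solution
  or several. The stages are indexed by the finite type \<open>'s\<close>.
\<close>

definition rk_step ::
  "real ^ 's ^ 's \<Rightarrow> real ^ 's \<Rightarrow> ('a::real_vector \<Rightarrow> 'a) \<Rightarrow> real \<Rightarrow> 'a \<Rightarrow> 'a \<Rightarrow> bool" where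
  "rk_step A b f h y y' \<longleftrightarrow>
     (\<exists>Y :: 's \<Rightarrow> 'a.
        (\<forall>i. Y i = y + h *\<^sub>R (\<Sum>j\<in>UNIV. (A $ i $ j) *\<^sub>R f (Y j))) \<and>
        y' = y + h *\<^sub>R (\<Sum>i\<in>UNIV. (b $ i) *\<^sub>R f (Y i)))"

definition rk_solution ::
  "real ^ 's ^ 's \<Rightarrow> real ^ 's \<Rightarrow> ('a::real_vector \<Rightarrow> 'a) \<Rightarrow> real \<Rightarrow> (nat \<Rightarrow> 'a) \<Rightarrow> bool" where
  "rk_solution A b f h u \<longleftrightarrow> (\<forall>n. rk_step A b f h (u n) (u (Suc n)))"

definition stage_matrix :: "real ^ 's ^ 's \<Rightarrow> complex \<Rightarrow> complex ^ 's ^ 's" where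
  "stage_matrix A z = mat 1 - (\<chi> i j. z * of_real (A $ i $ j))"

text \<open>Meaningful only where \<open>stage_matrix A z\<close> is invertible.\<close>

definition stability_function :: "real ^ 's ^ 's \<Rightarrow> real ^ 's \<Rightarrow> complex \<Rightarrow> complex" where
  "stability_function A b z =
     1 + z * (\<Sum>i\<in>UNIV. of_real (b $ i) * (matrix_inv (stage_matrix A z) *v (\<chi> j. 1)) $ i)"

text \<open>
  A predicate rather than a function: the growth rate is determined only modulo \<open>2 \<pi> \<i> / h\<close>,
  and none exists if the numerical solution \<open>u\<close> vanishes at some step.
\<close>

definition discrete_growth_rate :: "real \<Rightarrow> (nat \<Rightarrow> complex) \<Rightarrow> complex \<Rightarrow> bool" where
  "discrete_growth_rate h u \<mu> \<longleftrightarrow>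
     (\<exists>U\<^sub>0. U\<^sub>0 \<noteq> 0 \<and> (\<forall>n. u n = U\<^sub>0 * exp (of_nat n * of_real h * \<mu>)))"

end

theory Submission
  imports Defs
begin

text \<open>
  For the linear equation \<open>y' = c y\<close> the stage equations say that the vector \<open>Y\<close> of stage
  values satisfies \<open>(I - z A) Y = y 1\<close>, where \<open>z = h c\<close>. If \<open>I - z A\<close> is invertible, then
  \<open>Y = y (I - z A)\<inverse> 1\<close>, and inserting this into the update formula shows that every step
  multiplies \<open>y\<close> by \<open>R z\<close> (lemma \<open>rk_step_linear\<close>). A sequence
  \<open>U\<^sub>0 exp (n h \<mu>)\<close>, on the other hand, is multiplied by \<open>exp (h \<mu>)\<close> in every step. Comparing
  the two factors in the first step, where the nonzero amplitude \<open>U\<^sub>0\<close> cancels, gives the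
  identity.
\<close>

text \<open>
  The stage equations form a linear system with the stage matrix as coefficient matrix, so
  invertibility makes the stage values unique.
\<close>

lemma linear_stages:
  fixes A :: "real ^ 's ^ 's" and c y :: complex and Y :: "'s \<Rightarrow> complex"
  assumes inv: "invertible (stage_matrix A (of_real h * c))"
    and stages: "\<And>i. Y i = y + h *\<^sub>R (\<Sum>j\<in>UNIV. (A $ i $ j) *\<^sub>R (c * Y j))"
  shows "Y i = y * (matrix_inv (stage_matrix A (of_real h * c)) *v (\<chi> j. 1)) $ i"
proof -
  let ?S = "stage_matrix A (of_real h * c)"
  have left_inv: "matrix_inv ?S ** ?S = mat 1"
    using inv someI_ex[of "\<lambda>B. ?S ** B = mat 1 \<and> B ** ?S = mat 1"]
    unfolding invertible_def matrix_inv_def by blast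
  have "?S *v (\<chi> j. Y j) = y *s (\<chi> j. 1)"
  proof -
    have "(?S *v (\<chi> j. Y j)) $ i = y" for i
    proof -
      have "(?S *v (\<chi> j. Y j)) $ i
          = Y i - (\<Sum>j\<in>UNIV. of_real h * c * of_real (A $ i $ j) * Y j)"
        by (simp add: stage_matrix_def matrix_vector_mult_diff_rdistrib)
           (simp add: matrix_vector_mult_def)
      also have "(\<Sum>j\<in>UNIV. of_real h * c * of_real (A $ i $ j) * Y j)
          = h *\<^sub>R (\<Sum>j\<in>UNIV. (A $ i $ j) *\<^sub>R (c * Y j))"
        by (simp add: scaleR_conv_of_real sum_distrib_left mult_ac)
      finally show ?thesis
        using stages[of i] by simp
    qed
    then show ?thesis
      by (simp add: vec_eq_iff)
  qed
  then have "matrix_inv ?S *v (?S *v (\<chi> j. Y j)) = y *s (matrix_inv ?S *v (\<chi> j. 1))"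
    by (simp add: vector_scalar_commute)
  then have "(\<chi> j. Y j) = y *s (matrix_inv ?S *v (\<chi> j. 1))"
    by (simp add: matrix_vector_mul_assoc left_inv)
  then show ?thesis
    by (simp add: vec_eq_iff)
qed

lemma rk_step_linear:
  fixes A :: "real ^ 's ^ 's" and c y y' :: complex
  assumes inv: "invertible (stage_matrix A (of_real h * c))"
    and step: "rk_step A b (\<lambda>y. c * y) h y y'"
  shows "y' = stability_function A b (of_real h * c) * y"
proof -
  obtain Y where stages: "\<And>i. Y i = y + h *\<^sub>R (\<Sum>j\<in>UNIV. (A $ i $ j) *\<^sub>R (c * Y j))"
    and update: "y' = y + h *\<^sub>R (\<Sum>i\<in>UNIV. (b $ i) *\<^sub>R (c * Y i))"
    using step unfolding rk_step_def by blast
  show ?thesis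
    unfolding update linear_stages[OF inv stages] stability_function_def
    by (simp add: scaleR_conv_of_real sum_distrib_left sum_distrib_right algebra_simps)
qed

theorem proposition7:
  fixes A :: "real ^ 's ^ 's" and b :: "real ^ 's"
    and M \<epsilon> \<beta> u\<^sub>0 \<Delta>t :: real and F :: "real \<Rightarrow> real"
    and k :: "real ^ 'd"
    and u :: "nat \<Rightarrow> complex" and \<mu> :: complex
  assumes "M > 0" and "\<epsilon> > 0" and "\<beta> \<ge> 0" and "\<Delta>t > 0"
    and "\<forall>\<^sub>F x in nhds u\<^sub>0. F differentiable (at x)"
    and "deriv F differentiable (at u\<^sub>0)"
    and "invertible (stage_matrix A (of_real (\<Delta>t * mode_rate M \<epsilon> \<beta> F u\<^sub>0 k)))"
    and "rk_solution A b (\<lambda>\<eta>::complex. of_real (mode_rate M \<epsilon> \<beta> F u\<^sub>0 k) * \<eta>) \<Delta>t u"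
    and "discrete_growth_rate \<Delta>t u \<mu>"
  shows "exp (of_real \<Delta>t * \<mu>) =
    stability_function A b (of_real (\<Delta>t * mode_rate M \<epsilon> \<beta> F u\<^sub>0 k))"
proof -
  let ?c = "complex_of_real (mode_rate M \<epsilon> \<beta> F u\<^sub>0 k)"
  obtain U\<^sub>0 where nonzero: "U\<^sub>0 \<noteq> 0"
    and growth: "\<And>n. u n = U\<^sub>0 * exp (of_nat n * of_real \<Delta>t * \<mu>)"
    using assms(9) unfolding discrete_growth_rate_def by blast
  have "rk_step A b (\<lambda>\<eta>. ?c * \<eta>) \<Delta>t (u 0) (u (Suc 0))"
    using assms(8) unfolding rk_solution_def by blast
  then have "u (Suc 0) = stability_function A b (of_real \<Delta>t * ?c) * u 0"
    using assms(7) by (intro rk_step_linear) simp_all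
  then show ?thesis
    using nonzero growth[of 0] growth[of "Suc 0"] by simp
qed

end
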